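(* Let $M$ be a compact and connected Riemannian manifold without boundary, and let $(X_t)_t$ be a continuous flow on $M$ such that: (1) $(X_t)_t$ has at most finitely many equilibrium points; (2) the set $\mathrm{Per}((X_t)_t)$ of periodic points is dense in $M$; (3) $(X_t)_t$ is transitive; (4) for every $T>0$ the periodic orbits of $(X_t)_t$ with period smaller than $T$ form a subset of $M$ consisting of finitely many disjoint closed curves. Then $\mathcal{Z}^0((X_t)_t)$ is trivial, that is: for every $(Y_s)_s\in\mathcal{Z}^0((X_t)_t)$ there exists a constant $c\in\mathbb{R}$ such that $Y_t(x)=X_{ct}(x)$ for every $(t,x)\in\mathbb{R}\times M$.
   Context: A continuous flow is a continuous action $\mathbb{R}\times M\to M$, $(t,x)\mapsto X_t(x)$. An equilibrium point is a point $p$ with $X_t(p)=p$ for all $t$. A point $p$ is periodic if $X_t(p)=p$ for some $t>0$ and its period $\pi(p)=\inf\{t>0:X_t(p)=p\}$ is positive. The flow is transitive if there is $x\in M$ with $\{X_t(x):t\ge 0\}$ dense in $M$. $\mathcal{Z}^0((X_t)_t)$ is the set of continuous flows $(Y_s)_s$ on $M$ with $Y_s\circ X_t=X_t\circ Y_s$ for all $s,t\in\mathbb{R}$. *)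

theory Defs
  imports "HOL-Analysis.Analysis"
begin

section \<open>Riemannian manifolds\<close>

text \<open>These notions of differentiability are intended for open \<open>S\<close> only.\<close>

primrec C_differentiable_on ::
    "nat \<Rightarrow> ('e::real_normed_vector \<Rightarrow> 'f::real_normed_vector) \<Rightarrow> 'e set \<Rightarrow> bool" where
  "C_differentiable_on 0 f S \<longleftrightarrow> continuous_on S f"
| "C_differentiable_on (Suc k) f S \<longleftrightarrow>
     (\<forall>x\<in>S. f differentiable (at x)) \<and>
     (\<forall>v. C_differentiable_on k (\<lambda>x. frechet_derivative f (at x) v) S)"

definition smooth_on ::
    "('e::real_normed_vector \<Rightarrow> 'f::real_normed_vector) \<Rightarrow> 'e set \<Rightarrow> bool" where
  "smooth_on f S \<longleftrightarrow> (\<forall>k. C_differentiable_on k f S)"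

type_synonym ('a, 'e) chart = "'a set \<times> ('a \<Rightarrow> 'e)"

definition is_chart :: "('a::topological_space, 'e::euclidean_space) chart \<Rightarrow> bool" where
  "is_chart c \<longleftrightarrow> (case c of (U, \<phi>) \<Rightarrow>
     open U \<and> open (\<phi> ` U) \<and> homeomorphism U (\<phi> ` U) \<phi> (inv_into U \<phi>))"

definition transition :: "('a, 'e) chart \<Rightarrow> ('a, 'e) chart \<Rightarrow> 'e \<Rightarrow> 'e" where
  "transition c d = snd d \<circ> inv_into (fst c) (snd c)"

text \<open>
  The manifold is the whole type \<open>'a\<close>; the type classes provide the Hausdorff property and
  second countability. There is no boundary, since chart images are open in the model space
  \<open>'e\<close>, whose dimension is arbitrary but positive.
\<close>

locale smooth_manifold =
  fixes atlas :: "('a::{t2_space, second_countable_topology}, 'e::euclidean_space) chart set"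
  assumes charts: "c \<in> atlas \<Longrightarrow> is_chart c"
    and cover: "(\<Union>c\<in>atlas. fst c) = UNIV"
    and smooth_transition:
      "c \<in> atlas \<Longrightarrow> d \<in> atlas \<Longrightarrow> smooth_on (transition c d) (snd c ` (fst c \<inter> fst d))"

text \<open>
  The metric tensor is given by its coordinate representations: \<open>metric c p u v\<close> is the inner
  product at \<open>p\<close> of the tangent vectors whose coordinates in the chart \<open>c\<close> are \<open>u\<close> and \<open>v\<close>.
  The assumption \<open>metric_change\<close> is the transformation law of a covariant 2-tensor.
\<close>

locale riemannian_manifold = smooth_manifold atlas
  for atlas :: "('a::{t2_space, second_countable_topology}, 'e::euclidean_space) chart set" +
  fixes metric :: "('a, 'e) chart \<Rightarrow> 'a \<Rightarrow> 'e \<Rightarrow> 'e \<Rightarrow> real"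
  assumes metric_bilinear: "c \<in> atlas \<Longrightarrow> p \<in> fst c \<Longrightarrow> bilinear (metric c p)"
    and metric_sym: "c \<in> atlas \<Longrightarrow> p \<in> fst c \<Longrightarrow> metric c p u v = metric c p v u"
    and metric_pos: "c \<in> atlas \<Longrightarrow> p \<in> fst c \<Longrightarrow> v \<noteq> 0 \<Longrightarrow> metric c p v v > 0"
    and metric_smooth:
      "c \<in> atlas \<Longrightarrow>
         smooth_on (\<lambda>y. metric c (inv_into (fst c) (snd c) y) u v) (snd c ` fst c)"
    and metric_change:
      "c \<in> atlas \<Longrightarrow> d \<in> atlas \<Longrightarrow> p \<in> fst c \<inter> fst d \<Longrightarrow>
         metric c p u v =
           metric d p (frechet_derivative (transition c d) (at (snd c p)) u)
                      (frechet_derivative (transition c d) (at (snd c p)) v)"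

section \<open>Continuous flows\<close>

definition continuous_flow :: "(real \<Rightarrow> 'a::topological_space \<Rightarrow> 'a) \<Rightarrow> bool" where
  "continuous_flow X \<longleftrightarrow>
     (\<forall>x. X 0 x = x) \<and> (\<forall>s t x. X (s + t) x = X s (X t x)) \<and>
     continuous_on UNIV (\<lambda>(t, x). X t x)"

definition equilibrium_points :: "(real \<Rightarrow> 'a \<Rightarrow> 'a) \<Rightarrow> 'a set" where
  "equilibrium_points X = {p. \<forall>t. X t p = p}"

text \<open>Only meaningful at points that return to themselves at some positive time.\<close>

definition period :: "(real \<Rightarrow> 'a \<Rightarrow> 'a) \<Rightarrow> 'a \<Rightarrow> real" where
  "period X p = Inf {t. t > 0 \<and> X t p = p}"

definition Per :: "(real \<Rightarrow> 'a \<Rightarrow> 'a) \<Rightarrow> 'a set" where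
  "Per X = {p. (\<exists>t>0. X t p = p) \<and> period X p > 0}"

definition flow_orbit :: "(real \<Rightarrow> 'a \<Rightarrow> 'a) \<Rightarrow> 'a \<Rightarrow> 'a set" where
  "flow_orbit X p = range (\<lambda>t. X t p)"

definition transitive_flow :: "(real \<Rightarrow> 'a::topological_space \<Rightarrow> 'a) \<Rightarrow> bool" where
  "transitive_flow X \<longleftrightarrow> (\<exists>x. closure ((\<lambda>t. X t x) ` {0..}) = UNIV)"

text \<open>
  Closed curves are understood to be simple, i.e. embedded circles: the image of an arbitrary
  loop could be, by space-filling curves, all of a compact connected manifold.
\<close>

definition closed_curve :: "'a::topological_space set \<Rightarrow> bool" where
  "closed_curve C \<longleftrightarrow> (\<exists>g. simple_path g \<and> pathfinish g = pathstart g \<and> path_image g = C)"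

definition centralizer :: "(real \<Rightarrow> 'a::topological_space \<Rightarrow> 'a) \<Rightarrow> (real \<Rightarrow> 'a \<Rightarrow> 'a) set" where
  "centralizer X = {Y. continuous_flow Y \<and> (\<forall>s t. Y s \<circ> X t = X t \<circ> Y s)}"

end

theory Submission
  imports Defs
begin

text \<open>
  Let \<open>Y\<close> commute with \<open>X\<close>. The homeomorphism \<open>Y s\<close> preserves periods, so the path
  \<open>s \<mapsto> Y s p\<close> issuing from a periodic point \<open>p\<close> stays in the union of the periodic orbits whose
  period is below some bound. This union consists of finitely many disjoint closed curves, and
  the path cannot jump from one curve to another. Each of these curves is a single
  orbit (\<open>periodic_orbit_eq_closed_curve\<close>): a periodic orbit properly contained in a simple closed
  curve would be an arc, and an arc has the fixed point property, whereas the flow moves every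
  point of the orbit at half the period. Hence \<open>Y s p\<close> never leaves the \<open>X\<close>-orbit of \<open>p\<close>
  (\<open>centralizer_preserves_periodic_orbit\<close>). A flow on a circle that commutes with a rotation flow
  rotates with constant speed, so \<open>Y s p = X (c * s) p\<close> for all \<open>s\<close>, with a speed \<open>c\<close> that may
  depend on \<open>p\<close> (\<open>reparametrization_on_periodic_orbit\<close>).

  The remaining question is how \<open>c\<close> varies with \<open>p\<close>, and transitivity settles it. Let \<open>x\<close> have a
  dense forward orbit. Unless the space is a single point, \<open>X T x\<close> differs from \<open>x\<close> for some time
  \<open>T\<close>, so \<open>X T\<close> moves all points near \<open>x\<close> out of a neighbourhood of \<open>x\<close>. Conversely \<open>Y s\<close> moves
  the points near \<open>x\<close> only a little as long as \<open>\<bar>s\<bar>\<close> is below some \<open>\<delta>\<close>. A periodic point near \<open>x\<close>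
  with \<open>\<bar>c\<bar> * \<delta> > \<bar>T\<bar>\<close> would violate one of these, because \<open>Y (T / c)\<close> and \<open>X T\<close> agree there
  (\<open>locally_bounded_speed\<close>). With the speeds bounded near \<open>x\<close>, a limit of periodic points yields
  one \<open>c\<close> with \<open>Y s x = X (c * s) x\<close> for all \<open>s\<close>. This identity propagates along the orbit of \<open>x\<close>
  because the flows commute, and to the whole space by density.
\<close>

section \<open>Flows and commuting flows\<close>

lemma flow_zero: "continuous_flow X \<Longrightarrow> X 0 x = x"
  by (simp add: continuous_flow_def)

lemma flow_add: "continuous_flow X \<Longrightarrow> X s (X t x) = X (s + t) x"
  by (simp add: continuous_flow_def)

lemma flow_eq_cancel:
  assumes "continuous_flow X" "X a p = X b p"
  shows "X (a - b) p = p"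
proof -
  have "X (a - b) p = X (- b) (X a p)"
    using assms(1) by (simp add: flow_add)
  also have "\<dots> = p"
    using assms by (simp add: flow_add flow_zero)
  finally show ?thesis .
qed

lemma flow_eq_iff:
  assumes "continuous_flow X"
  shows "X t p = X t q \<longleftrightarrow> p = q"
proof
  assume "X t p = X t q"
  then have "X (- t) (X t p) = X (- t) (X t q)"
    by simp
  then show "p = q"
    using assms by (simp add: flow_add flow_zero)
qed simp

lemma continuous_on_flow:
  assumes "continuous_flow X" "continuous_on S f" "continuous_on S g"
  shows "continuous_on S (\<lambda>u. X (f u) (g u))"
proof -
  have "continuous_on UNIV (\<lambda>(t, x). X t x)"
    using assms(1) by (simp add: continuous_flow_def)
  from continuous_on_compose2[OF this continuous_on_Pair[OF assms(2,3)]]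
  show ?thesis by simp
qed

lemma centralizer_flow: "Y \<in> centralizer X \<Longrightarrow> continuous_flow Y"
  by (simp add: centralizer_def)

lemma centralizer_commute: "Y \<in> centralizer X \<Longrightarrow> Y s (X t x) = X t (Y s x)"
  by (auto simp: centralizer_def fun_eq_iff)

lemma flow_in_centralizer: "continuous_flow X \<Longrightarrow> X \<in> centralizer X"
  by (auto simp: centralizer_def fun_eq_iff flow_add add.commute)

text \<open>
  The pairs \<open>(s, t)\<close> with \<open>Y s p = X t p\<close> form a subgroup of the plane; for \<open>Y = X\<close> and \<open>t = 0\<close>
  this says that the multiples of a return time are return times.
\<close>

lemma commuting_flows_int_multiple:
  assumes X: "continuous_flow X" and Y: "Y \<in> centralizer X" and eq: "Y s p = X t p"
  shows "Y (of_int m * s) p = X (of_int m * t) p"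
proof -
  have nat: "Y (real n * s) p = X (real n * t) p" for n
  proof (induction n)
    case 0
    then show ?case
      using X centralizer_flow[OF Y] by (simp add: flow_zero)
  next
    case (Suc n)
    have "Y (real (Suc n) * s) p = Y (real n * s) (Y s p)"
      using centralizer_flow[OF Y] by (simp add: flow_add algebra_simps)
    also have "\<dots> = X t (Y (real n * s) p)"
      using eq Y by (simp add: centralizer_commute)
    also have "\<dots> = X (real (Suc n) * t) p"
      using X Suc by (simp add: flow_add algebra_simps)
    finally show ?case .
  qed
  have neg: "Y (- u) p = X (- v) p" if "Y u p = X v p" for u v
  proof -
    have "p = Y (- u) (Y u p)"
      using centralizer_flow[OF Y] by (simp add: flow_add flow_zero)
    also have "\<dots> = X v (Y (- u) p)"
      using that Y by (simp add: centralizer_commute)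
    finally have "X (- v) p = X (- v) (X v (Y (- u) p))"
      by simp
    then show ?thesis
      using X by (simp add: flow_add flow_zero)
  qed
  show ?thesis
  proof (cases "m \<ge> 0")
    case True
    then show ?thesis
      using nat[of "nat m"] by simp
  next
    case False
    then show ?thesis
      using neg[OF nat[of "nat (- m)"]] by simp
  qed
qed

section \<open>Periodic orbits\<close>

lemma period_pos: "p \<in> Per X \<Longrightarrow> 0 < period X p"
  by (simp add: Per_def)

lemma period_le:
  assumes "0 < t" "X t p = p"
  shows "period X p \<le> t"
  unfolding period_def
  by (rule cInf_lower) (use assms in \<open>auto intro!: bdd_belowI[of _ 0]\<close>)

lemma flow_period:
  fixes X :: "real \<Rightarrow> 'a::t2_space \<Rightarrow> 'a"
  assumes X: "continuous_flow X" and p: "p \<in> Per X"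
  shows "X (period X p) p = p"
proof -
  let ?R = "{t. 0 < t \<and> X t p = p}"
  \<comment> \<open>Since the infimum is positive, the return times form a closed set despite the condition
    \<open>0 < t\<close>.\<close>
  have R: "?R = {period X p..} \<inter> {t. X t p = p}"
  proof (intro subset_antisym subsetI)
    fix t
    assume "t \<in> ?R"
    then show "t \<in> {period X p..} \<inter> {t. X t p = p}"
      using period_le[of t X p] by simp
  next
    fix t
    assume "t \<in> {period X p..} \<inter> {t. X t p = p}"
    then show "t \<in> ?R"
      using period_pos[OF p] by simp
  qed
  have "closed {t. X t p = p}"
    by (intro closed_Collect_eq continuous_on_flow[OF X] continuous_intros)
  then have "closed ?R"
    unfolding R by (rule closed_Int[OF closed_atLeast])
  moreover have "?R \<noteq> {}"
    using p by (auto simp: Per_def)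
  moreover have "bdd_below ?R"
    by (auto intro!: bdd_belowI[of _ 0])
  ultimately have "Inf ?R \<in> ?R"
    by (intro closed_contains_Inf)
  then show ?thesis
    by (simp add: period_def)
qed

lemma flow_inj_within_period:
  assumes X: "continuous_flow X" and eq: "X a p = X b p" and ab: "\<bar>a - b\<bar> < period X p"
  shows "a = b"
proof (rule ccontr)
  assume "a \<noteq> b"
  then consider "0 < a - b" | "0 < b - a"
    by linarith
  then show False
  proof cases
    case 1
    then show False
      using period_le[of _ X p, OF 1 flow_eq_cancel[OF X eq]] ab by simp
  next
    case 2
    then show False
      using period_le[of _ X p, OF 2 flow_eq_cancel[OF X eq[symmetric]]] ab by simp
  qed
qed

lemma periodic_orbit_eq_image:
  fixes X :: "real \<Rightarrow> 'a::t2_space \<Rightarrow> 'a"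
  assumes X: "continuous_flow X" and p: "p \<in> Per X"
  shows "flow_orbit X p = (\<lambda>t. X t p) ` {a..a + period X p}"
proof -
  let ?P = "period X p"
  have "X t p \<in> (\<lambda>t. X t p) ` {a..a + ?P}" for t
  proof -
    define m where "m = \<lfloor>(t - a) / ?P\<rfloor>"
    have P: "0 < ?P"
      using p by (rule period_pos)
    have "of_int m \<le> (t - a) / ?P" "(t - a) / ?P \<le> of_int m + 1"
      unfolding m_def by linarith+
    then have bounds: "of_int m * ?P \<le> t - a" "t - a \<le> (of_int m + 1) * ?P"
      using P by (simp_all add: pos_le_divide_eq pos_divide_le_eq)
    have "X (of_int m * ?P) p = X (of_int m * 0) p"
      by (rule commuting_flows_int_multiple[OF X flow_in_centralizer[OF X]])
        (simp add: flow_period[OF X p] flow_zero[OF X])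
    then have "X (t - of_int m * ?P) (X (of_int m * ?P) p) = X (t - of_int m * ?P) p"
      using X by (simp add: flow_zero)
    then have "X t p = X (t - of_int m * ?P) p"
      using X by (simp add: flow_add)
    moreover have "t - of_int m * ?P \<in> {a..a + ?P}"
      using bounds by (simp add: algebra_simps)
    ultimately show ?thesis
      by (rule image_eqI)
  qed
  then show ?thesis
    unfolding flow_orbit_def by blast
qed

lemma compact_periodic_orbit:
  fixes X :: "real \<Rightarrow> 'a::t2_space \<Rightarrow> 'a"
  assumes X: "continuous_flow X" and p: "p \<in> Per X"
  shows "compact (flow_orbit X p)"
  unfolding periodic_orbit_eq_image[OF X p, of 0]
  by (intro compact_continuous_image continuous_on_flow[OF X] continuous_intros compact_Icc)

lemma connected_flow_orbit:
  assumes X: "continuous_flow X"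
  shows "connected (flow_orbit X p)"
  unfolding flow_orbit_def
  by (intro connected_continuous_image continuous_on_flow[OF X] continuous_intros connected_UNIV)

section \<open>Periodic orbits inside closed curves\<close>

text \<open>
  A compact connected proper subset of a simple closed curve is an arc or a point: cut the curve
  open at a missing point, so that the subset becomes a compact interval of parameters, on which
  every continuous self-map has a fixed point.
\<close>

lemma fixed_point_in_proper_subset_of_closed_curve:
  fixes C :: "'a::t2_space set"
  assumes C: "closed_curve C" and S: "S \<subset> C" "compact S" "connected S" "S \<noteq> {}"
    and f: "continuous_on S f" "f ` S \<subseteq> S"
  obtains x where "x \<in> S" "f x = x"
proof -
  obtain g where g: "simple_path g" "pathfinish g = pathstart g" "path_image g = C"
    using C by (auto simp: closed_curve_def)
  obtain z where z: "z \<in> C" "z \<notin> S"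
    using S(1) by blast
  obtain a where a: "a \<in> {0..1}" "g a = z"
    using z(1) g(3) by (auto simp: path_image_def)
  define h where "h = shiftpath a g"
  have h: "simple_path h" "path_image h = C" "h 0 = z" "h 1 = z"
    using a g simple_path_shiftpath[of g a] path_image_shiftpath[of a g]
      pathstart_shiftpath[of a g] pathfinish_shiftpath[of a g]
    by (auto simp: h_def pathstart_def pathfinish_def)
  have ch: "continuous_on {0..1} h"
    using h(1) by (simp add: simple_path_def path_def)
  define K where "K = {0..1} \<inter> h -` S"
  have "closed S"
    using S(2) by (rule compact_imp_closed)
  then have "closed K"
    unfolding K_def using ch by (intro continuous_closed_preimage closed_atLeastAtMost)
  then have cK: "compact K"
    unfolding K_def using compact_Int_closed[of "{0..1}" K] by (simp add: K_def)
  have chK: "continuous_on K h"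
    using ch by (rule continuous_on_subset) (auto simp: K_def)
  have hK: "h ` K = S"
    using S(1) h(2) by (force simp: K_def path_image_def)
  have "0 \<notin> K" "1 \<notin> K"
    using z(2) h(3,4) by (auto simp: K_def)
  then have "inj_on h K"
    using h(1) by (auto simp: inj_on_def K_def simple_path_def loop_free_def)
  then obtain k where k: "homeomorphism K S h k"
    using homeomorphism_compact[OF cK chK hK] by blast
  then have ck: "continuous_on S k" and kS: "k ` S = K"
    and kh: "\<And>u. u \<in> K \<Longrightarrow> k (h u) = u" and hk: "\<And>y. y \<in> S \<Longrightarrow> h (k y) = y"
    by (auto simp: homeomorphism_def)
  have "connected K"
    using connected_continuous_image[OF ck S(3)] kS by simp
  then have "convex K"
    by (simp only: is_interval_connected_1[symmetric] is_interval_convex_1)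
  moreover have "K \<noteq> {}"
    using hK S(4) by auto
  moreover have "continuous_on K (\<lambda>u. k (f (h u)))"
    using f hK
    by (intro continuous_on_compose2[OF ck] continuous_on_compose2[OF f(1) chK]) auto
  moreover have "(\<lambda>u. k (f (h u))) \<in> K \<rightarrow> K"
    using f(2) hK kS by blast
  ultimately obtain u where u: "u \<in> K" "k (f (h u)) = u"
    using brouwer[OF cK] by metis
  have "h u \<in> S" "f (h u) \<in> S"
    using u(1) hK f(2) by auto
  with hk u(2) have "f (h u) = h u"
    by metis
  with \<open>h u \<in> S\<close> that show thesis
    by blast
qed

text \<open>
  Otherwise the time-\<open>h\<close> map, for \<open>h\<close> half the period, would have a fixed point on the orbit, and
  \<open>h\<close> would be a return time shorter than the period.
\<close>

lemma periodic_orbit_eq_closed_curve: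
  fixes X :: "real \<Rightarrow> 'a::t2_space \<Rightarrow> 'a"
  assumes X: "continuous_flow X" and p: "p \<in> Per X"
    and C: "closed_curve C" and sub: "flow_orbit X p \<subseteq> C"
  shows "flow_orbit X p = C"
proof (rule ccontr)
  let ?h = "period X p / 2"
  assume "flow_orbit X p \<noteq> C"
  with sub have psub: "flow_orbit X p \<subset> C"
    by blast
  have "continuous_on (flow_orbit X p) (X ?h)"
    by (intro continuous_on_flow[OF X] continuous_intros)
  moreover have "X ?h ` flow_orbit X p \<subseteq> flow_orbit X p"
    using X by (auto simp: flow_orbit_def flow_add)
  moreover have "flow_orbit X p \<noteq> {}"
    by (simp add: flow_orbit_def)
  ultimately obtain q where "q \<in> flow_orbit X p" "X ?h q = q"
    using fixed_point_in_proper_subset_of_closed_curve[OF C psub compact_periodic_orbit[OF X p]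
        connected_flow_orbit[OF X]]
    by blast
  then obtain r where "X (?h + r) p = X r p"
    using X by (auto simp: flow_orbit_def flow_add)
  then show False
    using flow_inj_within_period[OF X, of "?h + r" p r] period_pos[OF p] by simp
qed

lemma connected_subset_of_finite_disjoint_closed:
  assumes fin: "finite \<C>" and dis: "disjoint \<C>" and cl: "\<And>C. C \<in> \<C> \<Longrightarrow> closed C"
    and S: "connected S" "S \<subseteq> \<Union>\<C>" and C: "C \<in> \<C>" "S \<inter> C \<noteq> {}"
  shows "S \<subseteq> C"
proof -
  have "closed C" "closed (\<Union>(\<C> - {C}))"
    using fin cl C(1) by (auto intro: closed_Union)
  moreover have "C \<inter> \<Union>(\<C> - {C}) = {}"
    using dis C(1) by (auto simp: disjoint_def)
  moreover have "S \<subseteq> C \<union> \<Union>(\<C> - {C})"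
    using S(2) by blast
  ultimately have "C \<inter> S = {} \<or> \<Union>(\<C> - {C}) \<inter> S = {}"
    using S(1) by (intro connected_closedD) auto
  with C S(2) show ?thesis
    by blast
qed

section \<open>The centralizer on periodic orbits\<close>

lemma centralizer_period:
  assumes "Y \<in> centralizer X"
  shows "period X (Y s p) = period X p" "Y s p \<in> Per X \<longleftrightarrow> p \<in> Per X"
proof -
  have "X t (Y s p) = Y s p \<longleftrightarrow> X t p = p" for t
    using centralizer_commute[OF assms, of s t p] flow_eq_iff[OF centralizer_flow[OF assms]]
    by metis
  then show "period X (Y s p) = period X p" "Y s p \<in> Per X \<longleftrightarrow> p \<in> Per X"
    by (simp_all add: period_def Per_def)
qed

lemma centralizer_preserves_periodic_orbit:
  fixes X :: "real \<Rightarrow> 'a::t2_space \<Rightarrow> 'a"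
  assumes X: "continuous_flow X" and Y: "Y \<in> centralizer X" and p: "p \<in> Per X"
    and curves: "finite \<C>" "disjoint \<C>" "\<And>C. C \<in> \<C> \<Longrightarrow> closed_curve C"
    and orbits: "(\<Union>q\<in>{q \<in> Per X. period X q < T}. flow_orbit X q) = \<Union>\<C>"
    and T: "period X p < T"
  shows "Y s p \<in> flow_orbit X p"
proof -
  have self: "q \<in> flow_orbit X q" for q
    unfolding flow_orbit_def using flow_zero[OF X, of q] by (metis rangeI)
  have sub: "flow_orbit X p \<subseteq> \<Union>\<C>"
    using p T orbits by blast
  then obtain C where C: "C \<in> \<C>" "p \<in> C"
    using self by blast
  have closed: "closed D" if "D \<in> \<C>" for D
    using curves(3)[OF that]
    by (auto simp: closed_curve_def intro: compact_imp_closed compact_simple_path_image)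
  have "flow_orbit X p \<subseteq> C"
    using self C
    by (intro connected_subset_of_finite_disjoint_closed[OF curves(1,2) closed
        connected_flow_orbit[OF X] sub C(1)]) auto
  then have "flow_orbit X p = C"
    using periodic_orbit_eq_closed_curve[OF X p] curves(3) C(1) by blast
  moreover have "flow_orbit Y p \<subseteq> C"
  proof (rule connected_subset_of_finite_disjoint_closed[OF curves(1,2) closed _ _ C(1)])
    show "connected (flow_orbit Y p)"
      using Y by (intro connected_flow_orbit centralizer_flow)
    have "Y r p \<in> \<Union>\<C>" for r
      unfolding orbits[symmetric] using p T self[of "Y r p"]
      by (auto simp: centralizer_period[OF Y] intro!: exI[of _ "Y r p"])
    then show "flow_orbit Y p \<subseteq> \<Union>\<C>"
      by (auto simp: flow_orbit_def)
    have "p \<in> flow_orbit Y p"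
      unfolding flow_orbit_def using flow_zero[OF centralizer_flow[OF Y], of p] by (metis rangeI)
    then show "flow_orbit Y p \<inter> C \<noteq> {}"
      using C(2) by blast
  qed
  ultimately show ?thesis
    by (auto simp: flow_orbit_def)
qed

text \<open>
  For small \<open>s\<close> the time \<open>t\<close> with \<open>Y s p = X t p\<close> can be chosen in a quarter period around \<open>0\<close>.
  There it is unique, hence halving \<open>s\<close> halves \<open>t\<close>, and the ratio \<open>t / s\<close> is the same for all dyadic
  fractions of a fixed \<open>s\<close> and their multiples, which are dense.
\<close>

lemma reparametrization_on_periodic_orbit:
  fixes X :: "real \<Rightarrow> 'a::t2_space \<Rightarrow> 'a"
  assumes X: "continuous_flow X" and Y: "Y \<in> centralizer X" and p: "p \<in> Per X"
    and orbit: "\<And>s. Y s p \<in> flow_orbit X p"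
  shows "\<exists>c. \<forall>s. Y s p = X (c * s) p"
proof -
  define a where "a = period X p / 4"
  have a: "0 < a" and per: "period X p = 4 * a"
    using period_pos[OF p] by (simp_all add: a_def)
  note Yf = centralizer_flow[OF Y]
  \<comment> \<open>\<open>K\<close> is the part of the orbit at least a quarter period away from \<open>p\<close>; \<open>Y s p\<close> avoids it for
    small \<open>s\<close>.\<close>
  define K where "K = (\<lambda>t. X t p) ` {a..3 * a}"
  have "compact K"
    unfolding K_def
    by (intro compact_continuous_image continuous_on_flow[OF X] continuous_intros compact_Icc)
  then have "closed K"
    by (rule compact_imp_closed)
  then have "open ((\<lambda>s. Y s p) -` (- K))"
    by (intro open_vimage open_Compl continuous_on_flow[OF Yf] continuous_intros)
  moreover have "0 \<in> (\<lambda>s. Y s p) -` (- K)"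
  proof -
    have "p \<noteq> X t p" if "t \<in> {a..3 * a}" for t
      using flow_inj_within_period[OF X, of t p 0] that a per by (auto simp: flow_zero[OF X])
    then show ?thesis
      by (auto simp: K_def flow_zero[OF Yf])
  qed
  ultimately have "\<exists>\<delta>>0. \<forall>s. dist s 0 < \<delta> \<longrightarrow> s \<in> (\<lambda>s. Y s p) -` (- K)"
    unfolding open_dist by blast
  then obtain \<delta> where \<delta>: "0 < \<delta>" "\<And>s. \<bar>s\<bar> < \<delta> \<Longrightarrow> Y s p \<notin> K"
    by auto
  have small: "\<exists>t. \<bar>t\<bar> \<le> a \<and> Y s p = X t p" if "\<bar>s\<bar> < \<delta>" for s
  proof -
    obtain t where t: "t \<in> {- a..- a + period X p}" "Y s p = X t p"
      using orbit[of s] unfolding periodic_orbit_eq_image[OF X p, of "- a"] by blast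
    then have "t < a"
      using \<delta>(2)[OF that] per by (auto simp: K_def)
    with t show ?thesis
      by (intro exI[of _ t]) auto
  qed
  define s0 where "s0 = \<delta> / 2"
  have s0: "0 < s0" "s0 < \<delta>"
    using \<delta>(1) by (simp_all add: s0_def)
  obtain t0 where t0: "\<bar>t0\<bar> \<le> a" "Y s0 p = X t0 p"
    using small[of s0] s0 by auto
  have pow: "\<bar>r / 2 ^ k\<bar> \<le> \<bar>r\<bar>" for r :: real and k :: nat
    using divide_left_mono[of 1 "2 ^ k" "\<bar>r\<bar>"] by (simp add: abs_divide)
  have dyadic: "Y (s0 / 2 ^ k) p = X (t0 / 2 ^ k) p" for k
  proof (induction k)
    case 0
    then show ?case
      using t0(2) by simp
  next
    case (Suc k)
    obtain t where t: "\<bar>t\<bar> \<le> a" "Y (s0 / 2 ^ Suc k) p = X t p"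
      using small[of "s0 / 2 ^ Suc k"] s0 pow[of s0 "Suc k"] by fastforce
    have "X (t0 / 2 ^ k) p = Y (2 * (s0 / 2 ^ Suc k)) p"
      using Suc by simp
    also have "\<dots> = X (2 * t) p"
      using commuting_flows_int_multiple[OF X Y t(2), of 2] by simp
    finally have "X (t0 / 2 ^ k) p = X (2 * t) p" .
    moreover have "\<bar>t0 / 2 ^ k - 2 * t\<bar> < period X p"
      using t(1) pow[of t0 k] t0(1) a per by linarith
    ultimately have "t0 / 2 ^ k = 2 * t"
      by (rule flow_inj_within_period[OF X])
    then have "t = t0 / 2 ^ Suc k"
      by simp
    then show ?case
      using t(2) by simp
  qed
  define c where "c = t0 / s0"
  have "closed {s. Y s p = X (c * s) p}"
    by (intro closed_Collect_eq continuous_on_flow[OF X] continuous_on_flow[OF Yf]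
        continuous_intros)
  moreover have "of_int \<lfloor>s * 2 ^ k / s0\<rfloor> * (s0 / 2 ^ k) \<in> {s. Y s p = X (c * s) p}" for s k
    using commuting_flows_int_multiple[OF X Y dyadic, of "\<lfloor>s * 2 ^ k / s0\<rfloor>" k] s0
    by (simp add: c_def mult.commute)
  moreover have "(\<lambda>k. of_int \<lfloor>s * 2 ^ k / s0\<rfloor> * (s0 / 2 ^ k)) \<longlonglongrightarrow> s" for s
  proof (rule LIM_zero_cancel, rule Lim_null_comparison)
    have "\<bar>of_int \<lfloor>s * 2 ^ k / s0\<rfloor> * (s0 / 2 ^ k) - s\<bar> \<le> s0 * (1 / 2) ^ k" for k :: nat
    proof -
      define u where "u = s * 2 ^ k / s0"
      have s: "s = u * (s0 / 2 ^ k)"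
        using s0 by (simp add: u_def)
      have "of_int \<lfloor>u\<rfloor> * (s0 / 2 ^ k) - s = (of_int \<lfloor>u\<rfloor> - u) * (s0 / 2 ^ k)"
        unfolding s by (rule left_diff_distrib[symmetric])
      moreover have "\<bar>of_int \<lfloor>u\<rfloor> - u\<bar> \<le> 1"
        by linarith
      ultimately have "\<bar>of_int \<lfloor>u\<rfloor> * (s0 / 2 ^ k) - s\<bar> \<le> 1 * \<bar>s0 / 2 ^ k\<bar>"
        by (simp only: abs_mult mult_right_mono abs_ge_zero)
      then show ?thesis
        using s0 by (simp add: u_def power_divide)
    qed
    then show "\<forall>\<^sub>F k in sequentially.
        norm (of_int \<lfloor>s * 2 ^ k / s0\<rfloor> * (s0 / 2 ^ k) - s) \<le> s0 * (1 / 2) ^ k"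
      by (intro always_eventually allI) (simp only: real_norm_def)
    show "(\<lambda>k. s0 * (1 / 2) ^ k) \<longlonglongrightarrow> 0"
      by (rule tendsto_mult_right_zero[OF LIMSEQ_power_zero]) simp
  qed
  ultimately have "s \<in> {s. Y s p = X (c * s) p}" for s
    by (rule closed_sequentially)
  then show ?thesis
    by blast
qed

section \<open>Bounded speeds and the passage to the limit\<close>

text \<open>
  If \<open>Y\<close> runs along the \<open>X\<close>-orbit of \<open>p\<close> with a large speed \<open>c\<close>, it reaches \<open>X T p\<close>, a point outside
  a neighbourhood of \<open>x\<close>, after the short time \<open>T / c\<close>. For \<open>p\<close> near \<open>x\<close> this contradicts the
  continuity of \<open>Y\<close> at time \<open>0\<close>.
\<close>

lemma locally_bounded_speed:
  fixes X :: "real \<Rightarrow> 'a::t2_space \<Rightarrow> 'a"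
  assumes X: "continuous_flow X" and Y: "continuous_flow Y" and moved: "X T x \<noteq> x"
  obtains W B where "open W" "x \<in> W"
    "\<And>p c. p \<in> W \<Longrightarrow> (\<And>s. Y s p = X (c * s) p) \<Longrightarrow> \<bar>c\<bar> \<le> B"
proof -
  obtain U V where UV: "open U" "open V" "x \<in> U" "X T x \<in> V" "U \<inter> V = {}"
    using hausdorff[OF moved] by blast
  have "open ((\<lambda>z. Y (fst z) (snd z)) -` U)"
    by (intro open_vimage UV(1) continuous_on_flow[OF Y] continuous_intros)
  moreover have "(0, x) \<in> (\<lambda>z. Y (fst z) (snd z)) -` U"
    using UV(3) by (simp add: flow_zero[OF Y])
  ultimately obtain A W1 where AW: "open A" "open W1" "(0, x) \<in> A \<times> W1"
      "A \<times> W1 \<subseteq> (\<lambda>z. Y (fst z) (snd z)) -` U"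
    by (rule open_prod_elim)
  have "\<exists>\<delta>>0. \<forall>s. dist s 0 < \<delta> \<longrightarrow> s \<in> A"
    using AW(1,3) unfolding open_dist by blast
  then obtain \<delta> where \<delta>: "0 < \<delta>" "\<And>s. \<bar>s\<bar> < \<delta> \<Longrightarrow> s \<in> A"
    by auto
  define W where "W = W1 \<inter> X T -` V"
  have "open W"
    unfolding W_def using AW(2) UV(2)
    by (intro open_Int open_vimage continuous_on_flow[OF X] continuous_intros)
  moreover have "x \<in> W"
    using AW(3) UV(4) by (simp add: W_def)
  moreover have "\<bar>c\<bar> \<le> \<bar>T\<bar> / \<delta>" if p: "p \<in> W" and c: "\<And>s. Y s p = X (c * s) p" for p c
  proof (rule ccontr)
    assume "\<not> \<bar>c\<bar> \<le> \<bar>T\<bar> / \<delta>"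
    then have less: "\<bar>T\<bar> < \<bar>c\<bar> * \<delta>"
      using \<delta>(1) by (simp add: pos_divide_less_eq not_le)
    then have "c \<noteq> 0"
      by auto
    with less have "\<bar>T / c\<bar> < \<delta>"
      by (simp add: abs_divide divide_less_eq mult.commute)
    then have "(T / c, p) \<in> A \<times> W1"
      using \<delta>(2) p by (simp add: W_def)
    then have "Y (T / c) p \<in> U"
      using AW(4) by auto
    moreover have "Y (T / c) p = X T p"
      using c[of "T / c"] \<open>c \<noteq> 0\<close> by simp
    moreover have "X T p \<in> V"
      using p by (simp add: W_def)
    ultimately show False
      using UV(5) by auto
  qed
  ultimately show thesis
    using that by blast
qed

text \<open>
  The bound \<open>B\<close> on the speeds makes a subsequence of them converge along a sequence tending to \<open>x\<close>.
\<close>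

lemma reparametrization_at_closure_point:
  fixes X :: "real \<Rightarrow> 'a::{t2_space, first_countable_topology} \<Rightarrow> 'a"
  assumes X: "continuous_flow X" and Y: "continuous_flow Y" and x: "x \<in> closure S"
    and S: "\<And>p. p \<in> S \<Longrightarrow> \<exists>c. \<bar>c\<bar> \<le> B \<and> (\<forall>s. Y s p = X (c * s) p)"
  shows "\<exists>c. \<forall>s. Y s x = X (c * s) x"
proof -
  obtain q where q: "\<And>n. q n \<in> S" "q \<longlonglongrightarrow> x"
    using x unfolding closure_sequential by blast
  have "\<forall>n. \<exists>c. \<bar>c\<bar> \<le> B \<and> (\<forall>s. Y s (q n) = X (c * s) (q n))"
    using S q(1) by blast
  then obtain c where c: "\<And>n. \<bar>c n\<bar> \<le> B" "\<And>n s. Y s (q n) = X (c n * s) (q n)"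
    by metis
  have "\<forall>n. c n \<in> {- B..B}"
    using c(1) by (simp add: abs_le_iff minus_le_iff)
  then obtain l r where r: "strict_mono r" "(c \<circ> r) \<longlonglongrightarrow> l"
    using seq_compactE[OF compact_imp_seq_compact[OF compact_Icc]] by metis
  have qr: "(q \<circ> r) \<longlonglongrightarrow> x"
    using q(2) r(1) by (rule LIMSEQ_subseq_LIMSEQ)
  have "Y s x = X (l * s) x" for s
  proof -
    have "closed {z. Y s (snd z) = X (fst z * s) (snd z)}"
      by (intro closed_Collect_eq continuous_on_flow[OF X] continuous_on_flow[OF Y]
          continuous_intros)
    moreover have "((c \<circ> r) n, (q \<circ> r) n) \<in> {z. Y s (snd z) = X (fst z * s) (snd z)}" for n
      using c(2) by simp
    moreover have "(\<lambda>n. ((c \<circ> r) n, (q \<circ> r) n)) \<longlonglongrightarrow> (l, x)"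
      using r(2) qr by (rule tendsto_Pair)
    ultimately have "(l, x) \<in> {z. Y s (snd z) = X (fst z * s) (snd z)}"
      by (rule closed_sequentially)
    then show ?thesis
      by simp
  qed
  then show ?thesis
    by blast
qed

lemma reparametrization_from_dense_orbit:
  fixes X :: "real \<Rightarrow> 'a::t2_space \<Rightarrow> 'a"
  assumes X: "continuous_flow X" and Y: "Y \<in> centralizer X"
    and dense: "closure (flow_orbit X x) = UNIV" and eq: "Y s x = X r x"
  shows "Y s y = X r y"
proof -
  have "closed {y. Y s y = X r y}"
    by (intro closed_Collect_eq continuous_on_flow[OF X]
        continuous_on_flow[OF centralizer_flow[OF Y]] continuous_intros)
  moreover have "flow_orbit X x \<subseteq> {y. Y s y = X r y}"
    using X eq by (auto simp: flow_orbit_def centralizer_commute[OF Y] flow_add add.commute)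
  ultimately have "closure (flow_orbit X x) \<subseteq> {y. Y s y = X r y}"
    by (intro closure_minimal)
  with dense show ?thesis
    by blast
qed

theorem theorem2:
  fixes atlas :: "('a::{t2_space, second_countable_topology}, 'e::euclidean_space) chart set"
    and metric :: "('a, 'e) chart \<Rightarrow> 'a \<Rightarrow> 'e \<Rightarrow> 'e \<Rightarrow> real"
    and X :: "real \<Rightarrow> 'a \<Rightarrow> 'a"
  assumes "riemannian_manifold atlas metric"
    and "compact (UNIV :: 'a set)"
    and "connected (UNIV :: 'a set)"
    and "continuous_flow X"
    and "finite (equilibrium_points X)"
    and "closure (Per X) = UNIV"
    and "transitive_flow X"
    and "\<And>T. T > 0 \<Longrightarrow>
           \<exists>\<C>. finite \<C> \<and> disjoint \<C> \<and> (\<forall>C\<in>\<C>. closed_curve C) \<and>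
             (\<Union>p\<in>{p \<in> Per X. period X p < T}. flow_orbit X p) = \<Union>\<C>"
  shows "\<forall>Y \<in> centralizer X. \<exists>c::real. \<forall>t x. Y t x = X (c * t) x"
proof
  fix Y
  assume Y: "Y \<in> centralizer X"
  note X = \<open>continuous_flow X\<close> and Yf = centralizer_flow[OF Y]
  have periodic: "\<exists>c. \<forall>s. Y s p = X (c * s) p" if p: "p \<in> Per X" for p
  proof (rule reparametrization_on_periodic_orbit[OF X Y p])
    fix s
    have "0 < period X p + 1"
      using period_pos[OF p] by simp
    from assms(8)[OF this] obtain \<C> where curves: "finite \<C>" "disjoint \<C>" "\<forall>C\<in>\<C>. closed_curve C"
      and orbits: "(\<Union>q\<in>{q \<in> Per X. period X q < period X p + 1}. flow_orbit X q) = \<Union>\<C>"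
      by (elim exE conjE)
    show "Y s p \<in> flow_orbit X p"
      by (rule centralizer_preserves_periodic_orbit[OF X Y p curves(1,2) _ orbits])
        (use curves(3) in auto)
  qed
  obtain x where x: "closure ((\<lambda>t. X t x) ` {0..}) = UNIV"
    using \<open>transitive_flow X\<close> unfolding transitive_flow_def by (elim exE)
  have "closure ((\<lambda>t. X t x) ` {0..}) \<subseteq> closure (flow_orbit X x)"
    by (intro closure_mono) (auto simp: flow_orbit_def)
  then have dense: "closure (flow_orbit X x) = UNIV"
    unfolding x by (rule top.extremum_uniqueI)
  have "\<exists>c. \<forall>s. Y s x = X (c * s) x"
  proof (cases "\<exists>T. X T x \<noteq> x")
    case True
    then obtain T where "X T x \<noteq> x" ..
    then obtain W B where W: "open W" "x \<in> W"
        "\<And>p c. p \<in> W \<Longrightarrow> (\<And>s. Y s p = X (c * s) p) \<Longrightarrow> \<bar>c\<bar> \<le> B"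
      using locally_bounded_speed[OF X Yf, of T x] by metis
    have "x \<in> closure (W \<inter> Per X)"
      using open_Int_closure_subset[OF W(1), of "Per X"] W(2) \<open>closure (Per X) = UNIV\<close> by auto
    then show ?thesis
    proof (rule reparametrization_at_closure_point[OF X Yf])
      fix p
      assume p: "p \<in> W \<inter> Per X"
      then obtain c where c: "\<And>s. Y s p = X (c * s) p"
        using periodic by blast
      have "\<bar>c\<bar> \<le> B"
        using p c by (intro W(3)) auto
      with c show "\<exists>c. \<bar>c\<bar> \<le> B \<and> (\<forall>s. Y s p = X (c * s) p)"
        by blast
    qed
  next
    \<comment> \<open>A fixed point with a dense orbit is the whole space, which is then a single point.\<close>
    case False
    then have "flow_orbit X x = {x}"
      by (auto simp: flow_orbit_def)
    with dense have "UNIV = {x}"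
      by simp
    then show ?thesis
      by (metis UNIV_I singletonD)
  qed
  then obtain c where "\<And>s. Y s x = X (c * s) x"
    by blast
  then have "\<forall>t y. Y t y = X (c * t) y"
    using reparametrization_from_dense_orbit[OF X Y dense] by blast
  then show "\<exists>c. \<forall>t x. Y t x = X (c * t) x" ..
qed

end
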